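(* Let $f,g:U\to\mathbb{R}_n$ be slice monogenic on an axially symmetric slice domain $U\subseteq\mathbb{R}^{n+1}$, let $I=I_1\in\mathbb{S}$, and write $f_I=\sum_A F_AI_A$, $g_I=\sum_B G_BI_B$ on $U\cap\mathbb{C}_I$ with $F_A,G_B:U\cap\mathbb{C}_I\to\mathbb{C}_I$ holomorphic, where $A,B$ range over the subsets of $\{2,\dots,n\}$. Then the definition $$\begin{aligned} f_I*g_I(z)&=\sum_{|A|\text{ even}}(-1)^{\frac{|A|}{2}}F_A(z)G_A(z)+\sum_{|A|\text{ odd}}(-1)^{\frac{|A|+1}{2}}F_A(z)\hat G_A(z)\\&\quad+\sum_{|A|\text{ even},\,B\ne A}F_A(z)G_B(z)I_AI_B+\sum_{|A|\text{ odd},\,B\neq A}F_A(z)\hat G_B(z)I_AI_B\end{aligned}$$ is equivalent to $$f_I*g_I(z)=\sum_{C\subseteq\{2,\dots,n\}}H_C(z)\,I_C,\qquad H_C(z):=\sum_{A,B:\ A\triangle B=C}\mathrm{sign}(A,B)\,F_A(z)\,\widetilde G_B(z),$$ where $$\widetilde G_B=\begin{cases}G_B&\text{if }|A|\text{ is even},\\ \hat G_B&\text{if }|A|\text{ is odd},\end{cases}\qquad \mathrm{sign}(A,B)=\begin{cases}(-1)^{\frac{|A|}{2}}&\text{if }A=B\text{ and }|A|\text{ even},\\(-1)^{\frac{|A|+1}{2}}&\text{if }A=B\text{ and }|A|\text{ odd},\\(-1)^{\sigma(A,B)}&\text{if }A\ne B;\end{cases}$$ that is, the two right-hand sides coincide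 for all $z\in U\cap\mathbb{C}_I$.
   Context: $\mathbb{R}_n$ is the real unital associative algebra generated by $I_1,\dots,I_n$ with $I_iI_j+I_jI_i=-2\delta_{ij}$. For $A=\{a_1<\dots<a_k\}\subseteq\{2,\dots,n\}$, $I_A=I_{a_1}\cdots I_{a_k}$, $I_\emptyset=1$. $(x_0,\dots,x_n)\in\mathbb{R}^{n+1}$ is identified with $x_0+x_1I_1+\dots+x_nI_n$; $\mathbb{S}$ is the set of unit 1-vectors ($I^2=-1$ for $I\in\mathbb{S}$), $\mathbb{C}_I=\mathbb{R}+I\mathbb{R}$. Given $I\in\mathbb{S}$, set $I_1=I$ and complete to unit 1-vectors $I_1,\dots,I_n$ generating $\mathbb{R}_n$ and satisfying the same relations. A real-differentiable $f:U\to\mathbb{R}_n$ is slice monogenic if for all $I\in\mathbb{S}$, $f_I=f|_{U\cap\mathbb{C}_I}$ satisfies $\frac12(\partial_u+I\partial_v)f_I(u+Iv)=0$. A slice domain is a domain $U$ meeting $\mathbb{R}$ with $U\cap\mathbb{C}_I$ a domain in $\mathbb{C}_I$ for all $I\in\mathbb{S}$; it is axially symmetric if $u+Iv\in U$ implies $u+Jv\in U$ for all $J\in\mathbb{S}$. Every slice monogenic $f$ has a splitting $f_I=\sum_{A\subseteq\{2,\dots,n\}}F_AI_A$ with $F_A:U\cap\mathbb{C}_I\to\mathbb{C}_I$ holomorphic. Notation: $\hat G(z)=\overline{G(\bar z)}$; $A\triangle B=(A\cup B)\setminus(A\cap B)$; $\sigma(A,B)=|A\cap B|+|\{(a,b)\in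 A\times B:a>b\}|$. *)

theory Defs
  imports "HOL-Analysis.Analysis"
begin

text \<open>
  The index type \<open>'n\<close> plays the role of \<open>{1, \<dots>, n}\<close>, with \<open>n = CARD('n)\<close>; the type
  \<open>'n clifford\<close> is the algebra \<open>\<real>\<^sub>n\<close>.  An element is given by its \<open>2 ^ n\<close> real coefficients with
  respect to the ordered monomials in the generators.
\<close>

typedef 'n clifford = "UNIV :: ('n set \<Rightarrow> real) set"
  morphisms mv_coeff mvec by simp

setup_lifting type_definition_clifford

lemma clifford_eq_iff: "x = y \<longleftrightarrow> (\<forall>A. mv_coeff x A = mv_coeff y A)"
  by (metis mv_coeff_inject ext)

text \<open>
  Sorting the concatenation of two increasing words \<open>A\<close> and \<open>B\<close> takes one sign change for each
  inversion, and cancelling each repeated generator (whose square is \<open>-1\<close>) takes another one.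
\<close>

definition sigma_exp :: "'a::linorder set \<Rightarrow> 'a set \<Rightarrow> nat" where
  "sigma_exp A B = card (A \<inter> B) + card {(a, b). a \<in> A \<and> b \<in> B \<and> a > b}"

lemma sigma_eq_prod:
  fixes A B :: "'a::{finite,linorder} set"
  shows "(-1::real) ^ sigma_exp A B = (\<Prod>a\<in>UNIV. \<Prod>b\<in>UNIV. if a \<in> A \<and> b \<in> B \<and> b \<le> a then -1 else 1)"
proof -
  let ?D = "(\<lambda>a. (a, a)) ` (A \<inter> B)" and ?E = "{(a, b). a \<in> A \<and> b \<in> B \<and> a > b}"
  let ?P = "{p. fst p \<in> A \<and> snd p \<in> B \<and> snd p \<le> fst p}"
  have "card ?D = card (A \<inter> B)" by (intro card_image inj_onI) auto
  moreover have "card (?D \<union> ?E) = card ?D + card ?E"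
    by (intro card_Un_disjoint) auto
  moreover have "?D \<union> ?E = ?P" by (auto simp: image_iff)
  ultimately have "sigma_exp A B = card ?P" unfolding sigma_exp_def by simp
  hence "(-1::real) ^ sigma_exp A B = (\<Prod>p\<in>?P. -1)" by simp
  also have "\<dots> = (\<Prod>p\<in>UNIV. if p \<in> ?P then -1 else 1)"
    by (simp add: prod.If_cases)
  also have "\<dots> = (\<Prod>a\<in>UNIV. \<Prod>b\<in>UNIV. if a \<in> A \<and> b \<in> B \<and> b \<le> a then -1 else 1)"
    unfolding prod.cartesian_product UNIV_Times_UNIV
    by (intro prod.cong) auto
  finally show ?thesis .
qed

lemma sigma_sym_diff_left:
  fixes A B C :: "'a::{finite,linorder} set"
  shows "(-1::real) ^ sigma_exp (sym_diff A B) C = (-1) ^ sigma_exp A C * (-1) ^ sigma_exp B C"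
  unfolding sigma_eq_prod prod.distrib[symmetric] by (intro prod.cong) auto

lemma sigma_sym_diff_right:
  fixes A B C :: "'a::{finite,linorder} set"
  shows "(-1::real) ^ sigma_exp A (sym_diff B C) = (-1) ^ sigma_exp A B * (-1) ^ sigma_exp A C"
  unfolding sigma_eq_prod prod.distrib[symmetric] by (intro prod.cong) auto

definition blade :: "'n set \<Rightarrow> 'n clifford" where
  "blade A = mvec (\<lambda>B. if B = A then 1 else 0)"

lemma coeff_blade: "mv_coeff (blade A) B = (if B = A then 1 else 0)"
  by (simp add: blade_def mvec_inverse)

lemma sum_coeff_blade:
  fixes h :: "'n::finite set \<Rightarrow> real"
  shows "(\<Sum>B\<in>UNIV. h B * mv_coeff (blade A) B) = h A"
proof -
  have "(\<Sum>B\<in>UNIV. h B * mv_coeff (blade A) B) = (\<Sum>B\<in>UNIV. if B = A then h B else 0)"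
    by (intro sum.cong) (auto simp: coeff_blade)
  thus ?thesis by simp
qed

instantiation clifford :: ("{finite,linorder}") real_algebra_1
begin

lift_definition zero_clifford :: "'a clifford" is "\<lambda>_. 0" .
lift_definition one_clifford :: "'a clifford" is "\<lambda>A. if A = {} then 1 else 0" .
lift_definition plus_clifford :: "'a clifford \<Rightarrow> 'a clifford \<Rightarrow> 'a clifford"
  is "\<lambda>x y A. x A + y A" .
lift_definition minus_clifford :: "'a clifford \<Rightarrow> 'a clifford \<Rightarrow> 'a clifford"
  is "\<lambda>x y A. x A - y A" .
lift_definition uminus_clifford :: "'a clifford \<Rightarrow> 'a clifford" is "\<lambda>x A. - x A" .
lift_definition scaleR_clifford :: "real \<Rightarrow> 'a clifford \<Rightarrow> 'a clifford"
  is "\<lambda>r x A. r * x A" .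

text \<open>The coefficient at \<open>C\<close> collects the pairs \<open>(A, B)\<close> with \<open>sym_diff A B = C\<close>.\<close>

lift_definition times_clifford :: "'a clifford \<Rightarrow> 'a clifford \<Rightarrow> 'a clifford"
  is "\<lambda>x y C. \<Sum>A\<in>UNIV. (-1) ^ sigma_exp A (sym_diff A C) * x A * y (sym_diff A C)" .

lemmas coeff_simps = zero_clifford.rep_eq one_clifford.rep_eq plus_clifford.rep_eq
  minus_clifford.rep_eq uminus_clifford.rep_eq scaleR_clifford.rep_eq times_clifford.rep_eq

instance
proof
  fix x y z :: "'a clifford" and r s :: real
  have sd: "sym_diff A (sym_diff A C) = C" for A C :: "'a set" by auto
  have bij: "bij (sym_diff A)" for A :: "'a set"
    by (rule involuntory_imp_bij) (rule sd)
  show "x * y * z = x * (y * z)"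
    unfolding clifford_eq_iff coeff_simps
  proof
    fix C :: "'a set"
    have "(\<Sum>D\<in>UNIV. (-1) ^ sigma_exp D (sym_diff D C) *
            (\<Sum>A\<in>UNIV. (-1) ^ sigma_exp A (sym_diff A D) * mv_coeff x A * mv_coeff y (sym_diff A D)) *
              mv_coeff z (sym_diff D C))
        = (\<Sum>A\<in>UNIV. \<Sum>D\<in>UNIV. (-1) ^ sigma_exp D (sym_diff D C) *
            ((-1) ^ sigma_exp A (sym_diff A D) * mv_coeff x A * mv_coeff y (sym_diff A D)) *
              mv_coeff z (sym_diff D C))"
      unfolding sum_distrib_left sum_distrib_right by (rule sum.swap)
    also have "\<dots> = (\<Sum>A\<in>UNIV. \<Sum>B\<in>UNIV. (-1) ^ sigma_exp (sym_diff A B) (sym_diff (sym_diff A B) C) *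
            ((-1) ^ sigma_exp A B * mv_coeff x A * mv_coeff y B) *
              mv_coeff z (sym_diff (sym_diff A B) C))"
    proof (rule sum.cong)
      fix A :: "'a set"
      show "(\<Sum>D\<in>UNIV. (-1) ^ sigma_exp D (sym_diff D C) *
            ((-1) ^ sigma_exp A (sym_diff A D) * mv_coeff x A * mv_coeff y (sym_diff A D)) *
              mv_coeff z (sym_diff D C)) = (\<Sum>B\<in>UNIV. (-1) ^ sigma_exp (sym_diff A B) (sym_diff (sym_diff A B) C) *
            ((-1) ^ sigma_exp A B * mv_coeff x A * mv_coeff y B) *
              mv_coeff z (sym_diff (sym_diff A B) C))"
        by (subst sum.reindex_bij_betw[OF bij[of A], symmetric]) (simp only: sd)
    qed simp
    also have "\<dots> = (\<Sum>A\<in>UNIV. \<Sum>B\<in>UNIV. (-1) ^ sigma_exp A (sym_diff A C) * mv_coeff x A *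
       ((-1) ^ sigma_exp B (sym_diff B (sym_diff A C)) * mv_coeff y B * mv_coeff z (sym_diff B (sym_diff A C))))"
    proof (intro sum.cong refl)
      fix A B :: "'a set"
      define E where "E = sym_diff B (sym_diff A C)"
      have E: "sym_diff (sym_diff A B) C = E" "sym_diff A C = sym_diff B E"
        unfolding E_def by auto
      show "(-1) ^ sigma_exp (sym_diff A B) (sym_diff (sym_diff A B) C) *
            ((-1) ^ sigma_exp A B * mv_coeff x A * mv_coeff y B) * mv_coeff z (sym_diff (sym_diff A B) C)
          = (-1) ^ sigma_exp A (sym_diff A C) * mv_coeff x A *
       ((-1) ^ sigma_exp B (sym_diff B (sym_diff A C)) * mv_coeff y B * mv_coeff z (sym_diff B (sym_diff A C)))"
        unfolding E_def[symmetric] E(1) unfolding E(2) sigma_sym_diff_left sigma_sym_diff_right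
        by (simp add: mult_ac)
    qed
    finally show "(\<Sum>D\<in>UNIV. (-1) ^ sigma_exp D (sym_diff D C) *
            (\<Sum>A\<in>UNIV. (-1) ^ sigma_exp A (sym_diff A D) * mv_coeff x A * mv_coeff y (sym_diff A D)) *
              mv_coeff z (sym_diff D C)) = (\<Sum>A\<in>UNIV. (-1) ^ sigma_exp A (sym_diff A C) * mv_coeff x A *
       (\<Sum>B\<in>UNIV. (-1) ^ sigma_exp B (sym_diff B (sym_diff A C)) * mv_coeff y B * mv_coeff z (sym_diff B (sym_diff A C))))"
      unfolding sum_distrib_left .
  qed
  have [simp]: "sigma_exp {} A = 0" "sigma_exp A {} = 0" for A :: "'a set" by (auto simp: sigma_exp_def)
  have eq: "sym_diff A C = {} \<longleftrightarrow> A = C" for A C :: "'a set" by auto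
  show "1 * x = x"
    unfolding clifford_eq_iff coeff_simps by (simp add: if_distrib if_distribR cong: if_cong)
  show "x * 1 = x"
    unfolding clifford_eq_iff coeff_simps eq by (simp add: if_distrib if_distribR cong: if_cong)
  show "(x + y) * z = x * z + y * z" "x * (y + z) = x * y + x * z"
    unfolding clifford_eq_iff coeff_simps by (simp_all add: sum.distrib algebra_simps)
  show "r *\<^sub>R x * y = r *\<^sub>R (x * y)" "x * r *\<^sub>R y = r *\<^sub>R (x * y)"
    unfolding clifford_eq_iff coeff_simps by (simp_all add: sum_distrib_left mult_ac)
  show "(0::'a clifford) \<noteq> 1" unfolding clifford_eq_iff coeff_simps by auto
qed (simp_all add: clifford_eq_iff coeff_simps algebra_simps)

end

text \<open>The norm is the Euclidean norm of the coefficient vector; it is not submultiplicative.\<close>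

instantiation clifford :: ("{finite,linorder}") euclidean_space
begin

definition inner_clifford :: "'a clifford \<Rightarrow> 'a clifford \<Rightarrow> real" where
  "inner_clifford x y = (\<Sum>A\<in>UNIV. mv_coeff x A * mv_coeff y A)"
definition norm_clifford :: "'a clifford \<Rightarrow> real" where
  "norm_clifford x = sqrt (inner x x)"
definition sgn_clifford :: "'a clifford \<Rightarrow> 'a clifford" where
  "sgn_clifford x = x /\<^sub>R norm x"
definition dist_clifford :: "'a clifford \<Rightarrow> 'a clifford \<Rightarrow> real" where
  "dist_clifford x y = norm (x - y)"
definition uniformity_clifford :: "('a clifford \<times> 'a clifford) filter" where
  "uniformity_clifford = (INF e\<in>{0<..}. principal {(x, y). dist x y < e})"
definition open_clifford :: "'a clifford set \<Rightarrow> bool" where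
  "open_clifford S \<longleftrightarrow> (\<forall>x\<in>S. \<forall>\<^sub>F (x', y) in uniformity. x' = x \<longrightarrow> y \<in> S)"
definition Basis_clifford :: "'a clifford set" where
  "Basis_clifford = range blade"

instance
proof
  fix x y z :: "'a clifford" and r :: real
  show "inner x y = inner y x" by (simp add: inner_clifford_def mult.commute)
  show "inner (x + y) z = inner x z + inner y z"
    by (simp add: inner_clifford_def coeff_simps sum.distrib algebra_simps)
  show "inner (r *\<^sub>R x) y = r * inner x y"
    by (simp add: inner_clifford_def coeff_simps sum_distrib_left mult_ac)
  show "0 \<le> inner x x" by (simp add: inner_clifford_def sum_nonneg)
  show "inner x x = 0 \<longleftrightarrow> x = 0"
    by (simp add: inner_clifford_def clifford_eq_iff coeff_simps sum_nonneg_eq_0_iff)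
  show "(Basis :: 'a clifford set) \<noteq> {}" "finite (Basis :: 'a clifford set)"
    by (auto simp: Basis_clifford_def)
  show "inner u v = (if u = v then 1 else 0)" if "u \<in> Basis" "v \<in> Basis" for u v :: "'a clifford"
  proof -
    from that obtain A B where uv: "u = blade A" "v = blade B"
      by (auto simp: Basis_clifford_def)
    have "u = v \<longleftrightarrow> A = B" unfolding uv clifford_eq_iff coeff_blade by (metis zero_neq_one)
    thus ?thesis
      unfolding inner_clifford_def uv(2) sum_coeff_blade by (simp add: uv coeff_blade eq_commute)
  qed
  show "(\<forall>u\<in>Basis. inner x u = 0) \<longleftrightarrow> x = 0"
    by (simp add: inner_clifford_def Basis_clifford_def sum_coeff_blade clifford_eq_iff coeff_simps)
qed (simp_all add: norm_clifford_def sgn_clifford_def dist_clifford_def uniformity_clifford_def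
      open_clifford_def)

end

definition gen :: "'n::{finite,linorder} \<Rightarrow> 'n clifford" where
  "gen i = blade {i}"

lemma blade_mult:
  fixes A B :: "'n::{finite,linorder} set"
  shows "blade A * blade B = (-1) ^ sigma_exp A B *\<^sub>R blade (sym_diff A B)"
  unfolding clifford_eq_iff
proof
  fix C :: "'n set"
  have 1: "sym_diff A C = B \<longleftrightarrow> C = sym_diff A B" by auto
  have 2: "sym_diff A (sym_diff A B) = B" by auto
  have "mv_coeff (blade A * blade B) C
      = (\<Sum>D\<in>UNIV. ((-1) ^ sigma_exp D (sym_diff D C) * mv_coeff (blade B) (sym_diff D C)) * mv_coeff (blade A) D)"
    unfolding coeff_simps by (intro sum.cong) simp_all
  also have "\<dots> = (-1) ^ sigma_exp A (sym_diff A C) * mv_coeff (blade B) (sym_diff A C)"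
    by (rule sum_coeff_blade)
  also have "\<dots> = mv_coeff ((-1) ^ sigma_exp A B *\<^sub>R blade (sym_diff A B)) C"
    unfolding coeff_simps coeff_blade 1 by (cases "C = sym_diff A B") (simp_all add: 2)
  finally show "mv_coeff (blade A * blade B) C = mv_coeff ((-1) ^ sigma_exp A B *\<^sub>R blade (sym_diff A B)) C" .
qed

lemma gen_relations:
  "gen i * gen j + gen j * gen i = (if i = j then -2 else 0)"
proof (cases "i = j")
  case True
  have "sigma_exp {j} {j} = 1" by (auto simp: sigma_exp_def)
  moreover have "blade {} = (1 :: 'a clifford)" by (simp add: clifford_eq_iff coeff_blade coeff_simps)
  moreover have "gen j * gen j + gen j * gen j = (2::real) *\<^sub>R (gen j * gen j)" 
    by (simp add: scaleR_2)
  ultimately show ?thesis using True blade_mult[of "{j}" "{j}"]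
    by (simp add: gen_def scaleR_conv_of_real)
next
  case False
  have "{(a, b). a = i \<and> b = j \<and> b < a} = (if j < i then {(i,j)} else {})"
   "{(a, b). a = j \<and> b = i \<and> b < a} = (if i < j then {(j,i)} else {})"
    by auto
  hence "sigma_exp {i} {j} = (if j < i then 1 else 0)" "sigma_exp {j} {i} = (if i < j then 1 else 0)"
    using False by (auto simp: sigma_exp_def)
  moreover have "sym_diff {i} {j} = sym_diff {j} {i}" by auto
  ultimately show ?thesis using False blade_mult[of "{i}" "{j}"] blade_mult[of "{j}" "{i}"]
    by (auto simp: gen_def)
qed

definition unital_subalgebra :: "'a::real_algebra_1 set \<Rightarrow> bool" where
  "unital_subalgebra T \<longleftrightarrow> subspace T \<and> 1 \<in> T \<and> (\<forall>x\<in>T. \<forall>y\<in>T. x * y \<in> T)"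

definition ordered_prod :: "('i::linorder \<Rightarrow> 'a::monoid_mult) \<Rightarrow> 'i set \<Rightarrow> 'a" where
  "ordered_prod e A = prod_list (map e (sorted_list_of_set A))"

lemma ordered_prod_gen: "ordered_prod gen A = blade A"
proof (use finite[of A] in \<open>induction A rule: finite_linorder_min_induct\<close>)
  case empty
  show ?case by (simp add: ordered_prod_def clifford_eq_iff coeff_blade coeff_simps)
next
  case (insert b A)
  have "sorted_list_of_set (insert b A) = b # sorted_list_of_set A"
  proof -
    have "A - {b} = A" using insert.hyps by auto
    thus ?thesis using insert.hyps
      by (simp add: sorted_list_of_set_insert_remove insort_is_Cons order_less_imp_le)
  qed
  hence "ordered_prod gen (insert b A) = blade {b} * blade A"
    unfolding insert.IH[symmetric] ordered_prod_def by (simp add: gen_def[of b])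
  moreover have "{(a, c). a = b \<and> c \<in> A \<and> c < a} = {}" "{b} \<inter> A = {}"
    "sym_diff {b} A = insert b A" using insert.hyps by auto
  ultimately show ?case by (simp add: blade_mult sigma_exp_def)
qed

lemma gen_generates: "unital_subalgebra hull range gen = UNIV"
proof -
  have "x \<in> T" if T: "unital_subalgebra T" "range gen \<subseteq> T" for x :: "'a clifford" and T
  proof -
    have "prod_list (map gen is) \<in> T" for "is" :: "'a list"
      by (induction "is") (use T in \<open>auto simp: unital_subalgebra_def\<close>)
    hence "Basis \<subseteq> T" by (auto simp: Basis_clifford_def ordered_prod_gen[symmetric] ordered_prod_def)
    hence "span Basis \<subseteq> T" using T(1) by (intro span_minimal) (auto simp: unital_subalgebra_def)
    thus ?thesis by auto
  qed
  thus ?thesis unfolding hull_def by blast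
qed

definition one_vectors :: "'n::{finite,linorder} clifford set" where
  "one_vectors = span (range gen)"

text \<open>\<open>\<real>\<^sup>n\<^sup>+\<^sup>1\<close>, identified with its image in the algebra.\<close>

definition paravectors :: "'n::{finite,linorder} clifford set" where
  "paravectors = {of_real x0 + x | x0 x. x \<in> one_vectors}"

definition unit_vectors :: "'n::{finite,linorder} clifford set" where
  "unit_vectors = {x \<in> one_vectors. norm x = 1}"

lemma one_vectors_relation:
  assumes "x \<in> one_vectors" "y \<in> one_vectors"
  shows "x * y + y * x = (- 2 * inner x y) *\<^sub>R 1"
proof -
  have gens: "gen i * gen j + gen j * gen i = (- 2 * inner (gen i) (gen j)) *\<^sub>R 1" for i j :: 'a
  proof -
    have "inner (gen i) (gen j) = (if i = j then 1 else 0)"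
      unfolding gen_def inner_clifford_def sum_coeff_blade by (auto simp: coeff_blade)
    thus ?thesis by (simp add: gen_relations scaleR_conv_of_real)
  qed
  have gen_vec: "gen i * y + y * gen i = (- 2 * inner (gen i) y) *\<^sub>R 1" for i
    using assms(2) unfolding one_vectors_def
  proof (induction y rule: span_induct_alt)
    case (step c b y)
    then obtain j where j: "b = gen j" by auto
    have "gen i * (c *\<^sub>R b + y) + (c *\<^sub>R b + y) * gen i
        = c *\<^sub>R (gen i * gen j + gen j * gen i) + (gen i * y + y * gen i)"
      by (simp add: j algebra_simps)
    thus ?case unfolding step.IH gens by (simp add: j inner_add_right algebra_simps)
  qed simp
  show ?thesis using assms(1) unfolding one_vectors_def
  proof (induction x rule: span_induct_alt)
    case (step c b x)
    then obtain j where j: "b = gen j" by auto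
    have "(c *\<^sub>R b + x) * y + y * (c *\<^sub>R b + x)
        = c *\<^sub>R (gen j * y + y * gen j) + (x * y + y * x)"
      by (simp add: j algebra_simps)
    thus ?case unfolding step.IH gen_vec
      by (simp add: j inner_add_left algebra_simps)
  qed simp
qed

lemma unit_vectors_square:
  assumes "I \<in> unit_vectors"
  shows "I * I = -1"
proof -
  have "inner I I = 1" using assms by (simp add: unit_vectors_def norm_eq_1)
  hence "2 *\<^sub>R (I * I) = 2 *\<^sub>R (-1)"
    using one_vectors_relation[of I I] assms by (simp add: unit_vectors_def scaleR_2)
  thus ?thesis by (simp only: scaleR_cancel_left) simp
qed

definition clifford_frame :: "(nat \<Rightarrow> 'n::{finite,linorder} clifford) \<Rightarrow> bool" where
  "clifford_frame e \<longleftrightarrow>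
     (\<forall>i\<in>{1..CARD('n)}. e i \<in> unit_vectors) \<and>
     unital_subalgebra hull (e ` {1..CARD('n)}) = UNIV \<and>
     (\<forall>i\<in>{1..CARD('n)}. \<forall>j\<in>{1..CARD('n)}. e i * e j + e j * e i = (if i = j then -2 else 0))"

definition slice_embed :: "'n::{finite,linorder} clifford \<Rightarrow> complex \<Rightarrow> 'n clifford" where
  "slice_embed I z = of_real (Re z) + Im z *\<^sub>R I"

definition slice :: "'n::{finite,linorder} clifford \<Rightarrow> 'n clifford set" where
  "slice I = range (slice_embed I)"

text \<open>
  Clifford conjugation: the anti-automorphism that negates the generators.  On each slice it is the
  usual complex conjugation, which is how it enters below.
\<close>

definition clifford_cnj :: "'n clifford \<Rightarrow> 'n clifford" where
  "clifford_cnj x = mvec (\<lambda>A. (-1) ^ (card A * (card A + 1) div 2) * mv_coeff x A)"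

lemma clifford_cnj_slice_embed:
  assumes "I \<in> unit_vectors"
  shows "clifford_cnj (slice_embed I z) = slice_embed I (cnj z)"
proof -
  have add: "clifford_cnj (x + y) = clifford_cnj x + clifford_cnj y"
    and scale: "clifford_cnj (r *\<^sub>R x) = r *\<^sub>R clifford_cnj x" for x y :: "'a clifford" and r
    by (simp_all add: clifford_eq_iff clifford_cnj_def mvec_inverse coeff_simps algebra_simps)
  have one: "clifford_cnj 1 = (1 :: 'a clifford)"
    by (simp add: clifford_eq_iff clifford_cnj_def mvec_inverse coeff_simps)
  have gen: "clifford_cnj (gen i) = - gen i" for i :: 'a
    by (simp add: clifford_eq_iff clifford_cnj_def mvec_inverse coeff_simps gen_def coeff_blade)
  have "I \<in> span (range gen)" using assms by (simp add: unit_vectors_def one_vectors_def)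
  hence "clifford_cnj I = - I"
  proof (induction rule: span_induct_alt)
    case base
    show ?case by (simp add: clifford_eq_iff clifford_cnj_def mvec_inverse coeff_simps)
  qed (auto simp: add scale gen)
  thus ?thesis by (simp add: slice_embed_def of_real_def add scale one)
qed

definition domain_in :: "'a::topological_space set \<Rightarrow> 'a set \<Rightarrow> bool" where
  "domain_in X D \<longleftrightarrow> openin (top_of_set X) D \<and> connected D \<and> D \<noteq> {}"

definition slice_domain :: "'n::{finite,linorder} clifford set \<Rightarrow> bool" where
  "slice_domain U \<longleftrightarrow> domain_in paravectors U \<and> U \<inter> \<real> \<noteq> {} \<and>
     (\<forall>I\<in>unit_vectors. domain_in (slice I) (U \<inter> slice I))"

definition axially_symmetric :: "'n::{finite,linorder} clifford set \<Rightarrow> bool" where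
  "axially_symmetric U \<longleftrightarrow>
     (\<forall>u v. \<forall>I\<in>unit_vectors. \<forall>J\<in>unit_vectors.
        of_real u + v *\<^sub>R I \<in> U \<longrightarrow> of_real u + v *\<^sub>R J \<in> U)"

text \<open>
  Differentiability \<open>within U\<close>, for \<open>U\<close> open in the paravectors, is differentiability as a function
  of \<open>n + 1\<close> real variables; \<open>f\<close> need not be defined off the paravectors.
\<close>

definition slice_monogenic_on ::
    "'n::{finite,linorder} clifford set \<Rightarrow> ('n clifford \<Rightarrow> 'n clifford) \<Rightarrow> bool" where
  "slice_monogenic_on U f \<longleftrightarrow>
     f differentiable_on U \<and>
     (\<forall>I\<in>unit_vectors. \<forall>u v. of_real u + v *\<^sub>R I \<in> U \<longrightarrow>
        (1/2) *\<^sub>R (vector_derivative (\<lambda>s. f (of_real s + v *\<^sub>R I)) (at u)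
               + I * vector_derivative (\<lambda>t. f (of_real u + t *\<^sub>R I)) (at v)) = 0)"

text \<open>
  A holomorphic \<open>\<complex>\<^sub>I\<close>-valued function on \<open>D \<subseteq> \<complex>\<^sub>I\<close>, where \<open>\<complex>\<^sub>I\<close> is identified with the complex
  numbers by \<^const>\<open>slice_embed\<close>.
\<close>

definition slice_holomorphic_on ::
    "'n::{finite,linorder} clifford \<Rightarrow> 'n clifford set \<Rightarrow> ('n clifford \<Rightarrow> 'n clifford) \<Rightarrow> bool" where
  "slice_holomorphic_on I D F \<longleftrightarrow>
     (\<exists>h. h holomorphic_on {z. slice_embed I z \<in> D} \<and>
          (\<forall>z. slice_embed I z \<in> D \<longrightarrow> F (slice_embed I z) = slice_embed I (h z)))"

definition hat :: "('n clifford \<Rightarrow> 'n clifford) \<Rightarrow> 'n clifford \<Rightarrow> 'n clifford" where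
  "hat G z = clifford_cnj (G (clifford_cnj z))"

definition star_tilde ::
    "nat set \<Rightarrow> ('n clifford \<Rightarrow> 'n clifford) \<Rightarrow> 'n clifford \<Rightarrow> 'n clifford" where
  "star_tilde A G = (if even (card A) then G else hat G)"

definition star_sign :: "nat set \<Rightarrow> nat set \<Rightarrow> real" where
  "star_sign A B =
     (if A = B then (if even (card A) then (-1) ^ (card A div 2) else (-1) ^ ((card A + 1) div 2))
      else (-1) ^ sigma_exp A B)"

definition star_coeff ::
    "(nat set \<Rightarrow> 'n clifford \<Rightarrow> 'n clifford) \<Rightarrow> (nat set \<Rightarrow> 'n clifford \<Rightarrow> 'n clifford) \<Rightarrow>
     nat set \<Rightarrow> 'n::{finite,linorder} clifford \<Rightarrow> 'n clifford" where
  "star_coeff F G C z =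
     (\<Sum>(A, B) | A \<subseteq> {2..CARD('n)} \<and> B \<subseteq> {2..CARD('n)} \<and> sym_diff A B = C.
        star_sign A B *\<^sub>R (F A z * star_tilde A (G B) z))"

end

theory Submission
  imports Defs
begin

text \<open>Both sides are one finite sum over pairs (A, B) of subsets of {2,...,n}, arranged in two
  ways. Grouping the pairs by C = \<open>sym_diff A B\<close> gives the sum of the H_C I_C
  (\<open>sum_star_coeff\<close>); separating diagonal from off-diagonal pairs, and each kind by the
  parity of |A|, gives the four sums of the definition (\<open>sum_Times_diagonal_split\<close>).
  The terms then agree pair by pair. For A = B the monomial I_C is 1 and both formulas prescribe the
  same sign. For A \<noteq> B the point is that I_A I_B = (-1)^sigma(A,B) I_C
  (\<open>clifford_frame_ordered_prod_mult\<close>): sorting the concatenated word costs one sign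
  per inversion, and cancelling each repeated generator costs another because its square is -1. The
  coefficients stand on the left in the same order in both formulas.\<close>

lemma ordered_prod_empty [simp]: "ordered_prod e {} = 1"
  by (simp add: ordered_prod_def)

text \<open>The inductions below build sets by adding new minima, so the added generator becomes the
  first letter of the increasing word.\<close>

lemma ordered_prod_insert_min:
  assumes "finite A" "\<And>a. a \<in> A \<Longrightarrow> b < a"
  shows "ordered_prod e (insert b A) = e b * ordered_prod e A"
proof -
  have "A - {b} = A" using assms(2) by auto
  thus ?thesis using assms
    by (simp add: ordered_prod_def sorted_list_of_set_insert_remove insort_is_Cons order_less_imp_le)
qed

text \<open>The two summands of \<open>sigma_exp\<close> merge: inversions count the elements of B
  strictly below a, and the intersection supplies the case b = a.\<close>

lemma sigma_exp_singleton:
  assumes "finite B"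
  shows "sigma_exp {a} B = card {b \<in> B. b \<le> a}"
proof -
  have "{(x, b). x \<in> {a} \<and> b \<in> B \<and> b < x} = Pair a ` {b \<in> B. b < a}" by auto
  hence "card {(x, b). x \<in> {a} \<and> b \<in> B \<and> b < x} = card {b \<in> B. b < a}"
    by (simp add: card_image inj_on_def)
  moreover have "{b \<in> B. b \<le> a} = ({a} \<inter> B) \<union> {b \<in> B. b < a}" by auto
  moreover have "card (({a} \<inter> B) \<union> {b \<in> B. b < a}) = card ({a} \<inter> B) + card {b \<in> B. b < a}"
    using assms by (intro card_Un_disjoint) auto
  ultimately show ?thesis by (simp add: sigma_exp_def)
qed

lemma sigma_exp_insert_left:
  assumes "finite A" "finite B" "a \<notin> A"
  shows "sigma_exp (insert a A) B = sigma_exp {a} B + sigma_exp A B"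
proof -
  let ?E = "\<lambda>A. {(x, b). x \<in> A \<and> b \<in> B \<and> b < x}"
  have fin: "finite (?E A)" if "finite A" for A
    by (rule finite_subset[of _ "A \<times> B"]) (use that assms(2) in auto)
  have "?E (insert a A) = ?E {a} \<union> ?E A" by auto
  moreover have "card (?E {a} \<union> ?E A) = card (?E {a}) + card (?E A)"
    using assms by (intro card_Un_disjoint fin) auto
  moreover have "insert a A \<inter> B = ({a} \<inter> B) \<union> (A \<inter> B)" by auto
  moreover have "card (({a} \<inter> B) \<union> (A \<inter> B)) = card ({a} \<inter> B) + card (A \<inter> B)"
    using assms by (intro card_Un_disjoint) auto
  ultimately show ?thesis by (simp add: sigma_exp_def)
qed

text \<open>The letter \<open>e a\<close> travels right through the increasing word of B. Each
  smaller letter it passes gives a sign, and if it meets itself the pair cancels to -1; so the sign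
  counts exactly the b \<le> a in B. The family e is kept abstract because \<open>blade_mult\<close>
  covers only the standard generators.\<close>

lemma generator_mult_ordered_prod:
  fixes e :: "'i::linorder \<Rightarrow> 'a::real_algebra_1"
  assumes sq: "\<And>i. i \<in> S \<Longrightarrow> e i * e i = -1"
    and anti: "\<And>i j. i \<in> S \<Longrightarrow> j \<in> S \<Longrightarrow> i \<noteq> j \<Longrightarrow> e i * e j = - (e j * e i)"
    and "a \<in> S" "finite B" "B \<subseteq> S"
  shows "e a * ordered_prod e B = (-1) ^ sigma_exp {a} B *\<^sub>R ordered_prod e (sym_diff {a} B)"
  using assms(4,5)
proof (induction B rule: finite_linorder_min_induct)
  case empty
  show ?case using ordered_prod_insert_min[of "{}" a e] by (simp add: sigma_exp_def)
next
  case (insert b B)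
  have b: "b \<in> S" and B: "B \<subseteq> S" using insert.prems by auto
  have prod_b: "ordered_prod e (insert b B) = e b * ordered_prod e B"
    using insert.hyps by (intro ordered_prod_insert_min) auto
  consider "a < b" | "a = b" | "b < a" by (rule linorder_cases)
  thus ?case
  proof cases
    case 1
    hence less: "a < c" if "c \<in> insert b B" for c
      using that insert.hyps(2) by (metis insertE order_less_trans)
    have none: "{c \<in> insert b B. c \<le> a} = {}" using less by (auto simp flip: not_less)
    have "a \<notin> insert b B" using less by blast
    hence "sym_diff {a} (insert b B) = insert a (insert b B)" by auto
    moreover have "sigma_exp {a} (insert b B) = 0"
      using insert.hyps(1) unfolding none sigma_exp_singleton[OF finite.insertI[OF insert.hyps(1)]] by simp
    ultimately show ?thesis
      using ordered_prod_insert_min[of "insert b B" a e] less insert.hyps(1) by simp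
  next
    case 2
    have "{c \<in> insert b B. c \<le> a} = {a}" using 2 insert.hyps(2) by force
    hence "sigma_exp {a} (insert b B) = 1"
      using insert.hyps(1) by (simp add: sigma_exp_singleton)
    moreover have "sym_diff {a} (insert b B) = B" using 2 insert.hyps(2) by auto
    moreover have "e a * ordered_prod e (insert b B) = - ordered_prod e B"
      unfolding prod_b using 2 sq[OF b] by (simp flip: mult.assoc)
    ultimately show ?thesis by simp
  next
    case 3
    \<comment> \<open>\<open>e b\<close> is the least letter both before and after
      \<open>e a\<close> is multiplied in, so it can be split off in front and put back there;
      exchanging the two costs the one sign by which the exponent grows.\<close>
    have less: "b < c" if "c \<in> sym_diff {a} B" for c using that 3 insert.hyps(2) by auto
    have "{c \<in> insert b B. c \<le> a} = insert b {c \<in> B. c \<le> a}" using 3 by auto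
    moreover have "b \<notin> B" using insert.hyps(2) by blast
    ultimately have sigma: "sigma_exp {a} (insert b B) = Suc (sigma_exp {a} B)"
      using insert.hyps(1) by (simp add: sigma_exp_singleton)
    have set: "sym_diff {a} (insert b B) = insert b (sym_diff {a} B)" using 3 \<open>b \<notin> B\<close> by auto
    have "e a * ordered_prod e (insert b B) = - (e b * (e a * ordered_prod e B))"
      unfolding prod_b using anti[OF \<open>a \<in> S\<close> b] 3 by (simp flip: mult.assoc)
    also have "\<dots> = - ((-1) ^ sigma_exp {a} B *\<^sub>R (e b * ordered_prod e (sym_diff {a} B)))"
      unfolding insert.IH[OF B] by simp
    also have "e b * ordered_prod e (sym_diff {a} B) = ordered_prod e (insert b (sym_diff {a} B))"
      using less insert.hyps(1) by (intro ordered_prod_insert_min[symmetric]) auto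
    finally show ?thesis unfolding sigma set by simp
  qed
qed

text \<open>Induction on A: the rest of the word acts on \<open>ordered_prod e B\<close> first, and
  the least letter of A is then multiplied in from the left.\<close>

lemma ordered_prod_mult:
  fixes e :: "'i::linorder \<Rightarrow> 'a::real_algebra_1"
  assumes sq: "\<And>i. i \<in> S \<Longrightarrow> e i * e i = -1"
    and anti: "\<And>i j. i \<in> S \<Longrightarrow> j \<in> S \<Longrightarrow> i \<noteq> j \<Longrightarrow> e i * e j = - (e j * e i)"
    and "finite A" "A \<subseteq> S" "finite B" "B \<subseteq> S"
  shows "ordered_prod e A * ordered_prod e B
       = (-1) ^ sigma_exp A B *\<^sub>R ordered_prod e (sym_diff A B)"
  using assms(3,4)
proof (induction A rule: finite_linorder_min_induct)
  case empty
  show ?case by (simp add: sigma_exp_def)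
next
  case (insert a A)
  have a: "a \<in> S" and A: "A \<subseteq> S" and "a \<notin> A" using insert.prems insert.hyps by auto
  have fin: "finite (sym_diff A B)" "sym_diff A B \<subseteq> S" using insert.hyps(1) A assms(5,6) by auto
  \<comment> \<open>All elements of A lie above a, so multiplying by the word of A leaves unchanged
    the letters that \<open>e a\<close> must pass or cancel: they are those of B.\<close>
  have "{c \<in> sym_diff A B. c \<le> a} = {c \<in> B. c \<le> a}" using insert.hyps(2) by (auto simp flip: not_less)
  hence sigma: "sigma_exp {a} (sym_diff A B) = sigma_exp {a} B"
    unfolding sigma_exp_singleton[OF fin(1)] sigma_exp_singleton[OF assms(5)] by simp
  have set: "sym_diff {a} (sym_diff A B) = sym_diff (insert a A) B" using \<open>a \<notin> A\<close> by auto
  have "ordered_prod e (insert a A) * ordered_prod e B = e a * (ordered_prod e A * ordered_prod e B)"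
    using insert.hyps by (simp add: ordered_prod_insert_min mult.assoc)
  also have "\<dots> = (-1) ^ sigma_exp A B *\<^sub>R (e a * ordered_prod e (sym_diff A B))"
    unfolding insert.IH[OF A] by simp
  also have "e a * ordered_prod e (sym_diff A B)
      = (-1) ^ sigma_exp {a} B *\<^sub>R ordered_prod e (sym_diff (insert a A) B)"
    using generator_mult_ordered_prod[of S e, OF sq anti a fin] unfolding sigma set .
  finally show ?case
    by (simp add: sigma_exp_insert_left[OF insert.hyps(1) assms(5) \<open>a \<notin> A\<close>] power_add mult.commute)
qed

lemma clifford_frame_ordered_prod_mult:
  fixes e :: "nat \<Rightarrow> 'n::{finite,linorder} clifford"
  assumes e: "clifford_frame e" and "A \<subseteq> {1..CARD('n)}" "B \<subseteq> {1..CARD('n)}"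
  shows "ordered_prod e A * ordered_prod e B
       = (-1) ^ sigma_exp A B *\<^sub>R ordered_prod e (sym_diff A B)"
proof (rule ordered_prod_mult[of "{1..CARD('n)}"])
  show "e i * e i = -1" if "i \<in> {1..CARD('n)}" for i
    using e that unit_vectors_square unfolding clifford_frame_def by blast
  show "e i * e j = - (e j * e i)" if "i \<in> {1..CARD('n)}" "j \<in> {1..CARD('n)}" "i \<noteq> j" for i j
    using e that unfolding clifford_frame_def eq_neg_iff_add_eq_0 by simp
qed (use assms in \<open>auto intro: finite_subset\<close>)

text \<open>Each row of the square yields its diagonal entry and a remainder, and the rows are
  sorted by Q. With Q the parity of the cardinality this is the shape of the definition.\<close>

lemma sum_Times_diagonal_split:
  fixes h :: "'a \<times> 'a \<Rightarrow> 'b::comm_monoid_add"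
  assumes "finite P"
  shows "sum h (P \<times> P) = (\<Sum>a | a \<in> P \<and> Q a. h (a, a)) + (\<Sum>a | a \<in> P \<and> \<not> Q a. h (a, a))
      + (\<Sum>(a, b) | a \<in> P \<and> b \<in> P \<and> Q a \<and> b \<noteq> a. h (a, b))
      + (\<Sum>(a, b) | a \<in> P \<and> b \<in> P \<and> \<not> Q a \<and> b \<noteq> a. h (a, b))"
proof -
  have row: "(\<Sum>b\<in>P. h (a, b)) = h (a, a) + (\<Sum>b | b \<in> P \<and> b \<noteq> a. h (a, b))" if "a \<in> P" for a
  proof -
    have "{b. b \<in> P \<and> b \<noteq> a} = P - {a}" by auto
    thus ?thesis using sum.remove[OF assms that, of "\<lambda>b. h (a, b)"] by simp
  qed
  have part: "sum h ({a \<in> P. R a} \<times> P) = (\<Sum>a | a \<in> P \<and> R a. h (a, a))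
      + (\<Sum>(a, b) | a \<in> P \<and> b \<in> P \<and> R a \<and> b \<noteq> a. h (a, b))" for R
  proof -
    have "sum h ({a \<in> P. R a} \<times> P)
        = (\<Sum>a | a \<in> P \<and> R a. h (a, a) + (\<Sum>b | b \<in> P \<and> b \<noteq> a. h (a, b)))"
      by (simp add: sum.cartesian_product' row)
    also have "\<dots> = (\<Sum>a | a \<in> P \<and> R a. h (a, a))
        + (\<Sum>(a, b)\<in>Sigma {a \<in> P. R a} (\<lambda>a. {b \<in> P. b \<noteq> a}). h (a, b))"
      using assms by (simp add: sum.distrib sum.Sigma)
    also have "Sigma {a \<in> P. R a} (\<lambda>a. {b \<in> P. b \<noteq> a})
        = {(a, b). a \<in> P \<and> b \<in> P \<and> R a \<and> b \<noteq> a}" by auto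
    finally show ?thesis .
  qed
  have "P \<times> P = {a \<in> P. Q a} \<times> P \<union> {a \<in> P. \<not> Q a} \<times> P" by auto
  hence "sum h (P \<times> P) = sum h ({a \<in> P. Q a} \<times> P) + sum h ({a \<in> P. \<not> Q a} \<times> P)"
    using assms by (simp only:) (rule sum.union_disjoint; auto)
  thus ?thesis unfolding part by (simp add: ac_simps)
qed

text \<open>The sets of pairs with a given symmetric difference partition the square of the power
  set, and that difference is again a subset of {2,...,n}, so the sum over C loses no pair.\<close>

lemma sum_star_coeff:
  fixes F G :: "nat set \<Rightarrow> 'n::{finite,linorder} clifford \<Rightarrow> 'n clifford"
  shows "(\<Sum>C | C \<subseteq> {2..CARD('n)}. star_coeff F G C z * ordered_prod e C)
       = (\<Sum>(A, B)\<in>Pow {2..CARD('n)} \<times> Pow {2..CARD('n)}.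
            star_sign A B *\<^sub>R (F A z * star_tilde A (G B) z * ordered_prod e (sym_diff A B)))"
    (is "_ = sum ?h (?P \<times> ?P)")
proof -
  have "sum ?h (?P \<times> ?P) = (\<Sum>C\<in>?P. sum ?h {p \<in> ?P \<times> ?P. case_prod sym_diff p = C})"
    by (rule sum.group[symmetric]) auto
  also have "\<dots> = (\<Sum>C\<in>?P. star_coeff F G C z * ordered_prod e C)"
    unfolding star_coeff_def sum_distrib_right by (intro sum.cong) auto
  finally show ?thesis by (simp add: Pow_def)
qed

text \<open>The definition writes its signs as factors in the algebra, whereas
  \<open>star_sign\<close> is a real scalar.\<close>

lemma minus_one_power_mult:
  "(-1) ^ k * x = (-1) ^ k *\<^sub>R (x :: 'a::real_algebra_1)"
  by (cases "even k") simp_all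

text \<open>The monomial of the empty set is 1, and the diagonal cases of \<open>star_sign\<close>
  are literally the signs of the definition.\<close>

lemma star_sign_mult_diagonal:
  "star_sign A A *\<^sub>R (x * star_tilde A G z * ordered_prod e (sym_diff A A))
   = (if even (card A) then (-1) ^ (card A div 2) * x * G z
      else (-1) ^ ((card A + 1) div 2) * x * hat G z)"
  by (simp add: star_sign_def star_tilde_def minus_one_power_mult del: power_Suc)

lemma star_sign_mult_off_diagonal:
  fixes e :: "nat \<Rightarrow> 'n::{finite,linorder} clifford"
  assumes "clifford_frame e" "A \<subseteq> {2..CARD('n)}" "B \<subseteq> {2..CARD('n)}" "B \<noteq> A"
  shows "star_sign A B *\<^sub>R (x * ordered_prod e (sym_diff A B)) = x * ordered_prod e A * ordered_prod e B"
proof -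
  have "A \<subseteq> {1..CARD('n)}" "B \<subseteq> {1..CARD('n)}" using assms(2,3) by fastforce+
  from clifford_frame_ordered_prod_mult[OF assms(1) this] show ?thesis
    using assms(4) by (simp add: star_sign_def mult.assoc)
qed

theorem proposition3p16:
  fixes U :: "'n::{finite,linorder} clifford set"
    and f g :: "'n clifford \<Rightarrow> 'n clifford"
    and I :: "'n clifford"
    and e :: "nat \<Rightarrow> 'n clifford"
    and F G :: "nat set \<Rightarrow> 'n clifford \<Rightarrow> 'n clifford"
  assumes "slice_domain U" and "axially_symmetric U"
    and "slice_monogenic_on U f" and "slice_monogenic_on U g"
    and "I \<in> unit_vectors" and "clifford_frame e" and "e 1 = I"
    and "\<And>A. A \<subseteq> {2..CARD('n)} \<Longrightarrow> slice_holomorphic_on I (U \<inter> slice I) (F A)"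
    and "\<And>B. B \<subseteq> {2..CARD('n)} \<Longrightarrow> slice_holomorphic_on I (U \<inter> slice I) (G B)"
    and "\<And>z. z \<in> U \<inter> slice I \<Longrightarrow> f z = (\<Sum>A | A \<subseteq> {2..CARD('n)}. F A z * ordered_prod e A)"
    and "\<And>z. z \<in> U \<inter> slice I \<Longrightarrow> g z = (\<Sum>B | B \<subseteq> {2..CARD('n)}. G B z * ordered_prod e B)"
  shows "\<forall>z \<in> U \<inter> slice I.
      (\<Sum>A | A \<subseteq> {2..CARD('n)} \<and> even (card A). (-1) ^ (card A div 2) * F A z * G A z)
    + (\<Sum>A | A \<subseteq> {2..CARD('n)} \<and> odd (card A). (-1) ^ ((card A + 1) div 2) * F A z * hat (G A) z)
    + (\<Sum>(A, B) | A \<subseteq> {2..CARD('n)} \<and> B \<subseteq> {2..CARD('n)} \<and> even (card A) \<and> B \<noteq> A.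
         F A z * G B z * ordered_prod e A * ordered_prod e B)
    + (\<Sum>(A, B) | A \<subseteq> {2..CARD('n)} \<and> B \<subseteq> {2..CARD('n)} \<and> odd (card A) \<and> B \<noteq> A.
         F A z * hat (G B) z * ordered_prod e A * ordered_prod e B)
    = (\<Sum>C | C \<subseteq> {2..CARD('n)}. star_coeff F G C z * ordered_prod e C)"
  unfolding sum_star_coeff sum_Times_diagonal_split[where Q = "\<lambda>A. even (card A)",
      OF finite_Pow_iff[THEN iffD2, OF finite_atLeastAtMost]] prod.case star_sign_mult_diagonal Pow_iff
  \<comment> \<open>Both sides are now four sums over the same index sets in the same order and are
    compared summand by summand; the parity of A decides between \<open>G B\<close> and its
    \<open>hat\<close>.\<close>
  apply (intro ballI arg_cong2[where f = "(+)"] sum.cong;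
      clarsimp simp: star_tilde_def star_sign_mult_off_diagonal[OF assms(6)])
  done

end
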